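(* Assume SOCA. Let $X$ be a compact Hausdorff space, let $Y$ be a compact metric space, and let $\pi : X \to Y$ be a continuous surjection. Assume further that there is an uncountable $E \subseteq Y$ such that for each $y \in E$ there are three points $x_y^i \in \pi^{-1}\{y\}$ for $i = 0,1,2$ and (pairwise) disjoint open neighborhoods $U_y^i$ of $x_y^i$ in $X$ such that $\pi(U_y^i) \cap \pi(U_y^j) = \{y\}$ whenever $i \neq j$. Then $X$ has an uncountable discrete subset.
   Context: For any set $E$, let $E^\dagger = (E \times E) \setminus \{(x,x) : x \in E\}$. For $W \subseteq E^\dagger$ let $W^{-1} = \{(y,x) : (x,y) \in W\}$. If $W = W^{-1} \subseteq E^\dagger$, a set $T \subseteq E$ is $W$-free iff $T^\dagger \cap W = \emptyset$, and $T$ is $W$-connected iff $T^\dagger \subseteq W$. The pair $(E,W)$ is good iff $E$ is an uncountable separable metric space, $W = W^{-1}$ is an open subset of $E^\dagger$, and no uncountable subset of $E$ is $W$-free. The Semi Open Coloring Axiom (SOCA) is the assertion that whenever $(E,W)$ is good, there is an uncountable $W$-connected subset of $E$. A subset of a space is discrete if its subspace topology is discrete. *)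

theory Defs
  imports "HOL-Analysis.Analysis"
begin

definition offdiag :: "'a set \<Rightarrow> ('a \<times> 'a) set" where
  "offdiag E = (E \<times> E) - {(x, x) | x. x \<in> E}"

definition W_free :: "('a \<times> 'a) set \<Rightarrow> 'a set \<Rightarrow> bool" where
  "W_free W T \<longleftrightarrow> offdiag T \<inter> W = {}"

definition W_connected :: "('a \<times> 'a) set \<Rightarrow> 'a set \<Rightarrow> bool" where
  "W_connected W T \<longleftrightarrow> offdiag T \<subseteq> W"

definition good :: "'a set \<Rightarrow> ('a \<Rightarrow> 'a \<Rightarrow> real) \<Rightarrow> ('a \<times> 'a) set \<Rightarrow> bool" where
  "good E d W \<longleftrightarrow>
     uncountable E \<and> Metric_space E d \<and> separable_space (Metric_space.mtopology E d) \<and>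
     W = W\<inverse> \<and>
     openin (subtopology
               (prod_topology (Metric_space.mtopology E d) (Metric_space.mtopology E d))
               (offdiag E)) W \<and>
     \<not> (\<exists>T. T \<subseteq> E \<and> uncountable T \<and> W_free W T)"

text \<open>A formula of HOL cannot quantify over the type of the points of a space, so SOCA ranges
  over the spaces \<open>(E, d)\<close> with \<open>E\<close> a set of reals and \<open>d\<close> an arbitrary metric on \<open>E\<close>, unrelated to
  the usual one. This is no restriction, since a separable metric space has at most continuum many
  points: see \<open>SOCA_any_type\<close> below.\<close>

definition SOCA :: bool where
  "SOCA \<longleftrightarrow>
     (\<forall>(E :: real set) d W. good E d W \<longrightarrow>
        (\<exists>T. T \<subseteq> E \<and> uncountable T \<and> W_connected W T))"

lemma separable_metric_inj_real:
  assumes "Metric_space E d" "separable_space (Metric_space.mtopology E d)"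
  shows "\<exists>h :: 'a \<Rightarrow> real. inj_on h E"
proof -
  interpret Metric_space E d by fact
  obtain C where C: "countable C" "C \<subseteq> E" "mtopology closure_of C = E"
    using assms(2) by (auto simp: separable_space_def)
  define code where "code x = to_nat_on (C \<times> (UNIV :: nat set)) ` {(c, k). c \<in> C \<and> d x c < inverse (Suc k)}"
    for x
  have "inj_on code E"
  proof (rule inj_onI, rule ccontr)
    fix x y assume xy: "x \<in> E" "y \<in> E" "code x = code y" "x \<noteq> y"
    have "countable (C \<times> (UNIV :: nat set))" using C(1) by blast
    from inj_on_to_nat_on[OF this]
    have eq: "{(c, k). c \<in> C \<and> d x c < inverse (Suc k)} = {(c, k). c \<in> C \<and> d y c < inverse (Suc k)}"
      by (rule inj_on_image_eq_iff[THEN iffD1]) (use xy(3) in \<open>auto simp: code_def\<close>)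
    have "d x y > 0" using xy by simp
    then obtain k where k: "inverse (real (Suc k)) < d x y / 2"
      by (metis half_gt_zero reals_Archimedean)
    obtain c where c: "c \<in> C" "d x c < inverse (Suc k)"
    proof -
      have "x \<in> mtopology closure_of C" using C xy by simp
      then have "\<exists>c\<in>C. c \<in> mball x (inverse (Suc k))"
        unfolding metric_closure_of using inverse_positive_iff_positive of_nat_0_less_iff by blast
      then show ?thesis using that by auto
    qed
    then have "d y c < inverse (Suc k)" using eq by blast
    moreover have "d x y \<le> d x c + d y c"
      using triangle[of x c y] xy c C commute by (metis subsetD)
    ultimately show False using c k by linarith
  qed
  then have "E \<lesssim> (UNIV :: nat set set)" by (auto simp: lepoll_def)
  then have "E \<lesssim> (UNIV :: real set)"
    using nat_sets_eqpoll_reals lepoll_trans2 by blast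
  then show ?thesis by (auto simp: lepoll_def)
qed

lemma SOCA_any_type:
  fixes E :: "'a set"
  assumes SOCA "good E d W"
  shows "\<exists>T. T \<subseteq> E \<and> uncountable T \<and> W_connected W T"
proof -
  have W: "W = W\<inverse>" and ms: "Metric_space E d" and sep: "separable_space (Metric_space.mtopology E d)"
    and unc: "uncountable E" and nofree: "\<And>T. T \<subseteq> E \<Longrightarrow> uncountable T \<Longrightarrow> \<not> W_free W T"
    and opn: "openin (subtopology (prod_topology (Metric_space.mtopology E d)
               (Metric_space.mtopology E d)) (offdiag E)) W"
    using assms(2) unfolding good_def by auto
  interpret A: Metric_space E d by fact
  obtain h :: "'a \<Rightarrow> real" where h: "inj_on h E"
    using separable_metric_inj_real[OF ms sep] by blast
  define g where "g = inv_into E h"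
  define E' where "E' = h ` E"
  define d' where "d' a b = d (g a) (g b)" for a b
  define W' where "W' = {(a, b). a \<in> E' \<and> b \<in> E' \<and> (g a, g b) \<in> W}"
  have gh: "\<And>x. x \<in> E \<Longrightarrow> g (h x) = x" using h by (simp add: g_def)
  have gE: "\<And>a. a \<in> E' \<Longrightarrow> g a \<in> E" and hg: "\<And>a. a \<in> E' \<Longrightarrow> h (g a) = a"
    by (auto simp: E'_def gh)
  have hE: "\<And>x. x \<in> E \<Longrightarrow> h x \<in> E'" by (simp add: E'_def)
  have ginj: "\<And>a b. a \<in> E' \<Longrightarrow> b \<in> E' \<Longrightarrow> g a = g b \<longleftrightarrow> a = b" by (metis hg)
  have ms': "Metric_space E' d'"
    by unfold_locales (auto simp: d'_def A.commute gE ginj A.triangle)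
  interpret B: Metric_space E' d' by fact
  have cg: "continuous_map B.mtopology A.mtopology g"
    unfolding B.metric_continuous_map[OF ms] by (auto simp: d'_def gE)
  have ch: "continuous_map A.mtopology B.mtopology h"
    unfolding A.metric_continuous_map[OF ms'] by (auto simp: d'_def gh hE)
  have sep': "separable_space B.mtopology"
    using separable_space_continuous_map_image[OF sep ch] E'_def B.topspace_mtopology A.topspace_mtopology by metis
  have unc': "uncountable E'" using unc h by (simp add: E'_def countable_image_inj_eq)
  have W'conv: "W' = W'\<inverse>" using W by (auto simp: W'_def)
  obtain O' where O': "openin (prod_topology A.mtopology A.mtopology) O'" "W = O' \<inter> offdiag E"
    using opn by (auto simp: openin_subtopology)
  have "continuous_map (prod_topology B.mtopology B.mtopology) (prod_topology A.mtopology A.mtopology)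
          (\<lambda>(a, b). (g a, g b))"
    using cg continuous_map_prod_top by blast
  from openin_continuous_map_preimage[OF this O'(1)]
  have "openin (prod_topology B.mtopology B.mtopology) {(a, b). a \<in> E' \<and> b \<in> E' \<and> (g a, g b) \<in> O'}"
    by (rule back_subst[where P = "openin _"]) auto
  moreover have "W' = {(a, b). a \<in> E' \<and> b \<in> E' \<and> (g a, g b) \<in> O'} \<inter> offdiag E'"
    using O'(2) by (auto simp: W'_def offdiag_def gE ginj)
  ultimately have op': "openin (subtopology (prod_topology B.mtopology B.mtopology) (offdiag E')) W'"
    by (auto simp: openin_subtopology)
  have nofree': "\<not> (T \<subseteq> E' \<and> uncountable T \<and> W_free W' T)" for T
  proof
    assume T: "T \<subseteq> E' \<and> uncountable T \<and> W_free W' T"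
    then have "inj_on g T" by (metis inj_on_def ginj subsetD)
    then have "uncountable (g ` T)" using T by (simp add: countable_image_inj_eq)
    moreover have "g ` T \<subseteq> E" using T gE by blast
    moreover have "W_free W (g ` T)"
      using T unfolding W_free_def offdiag_def W'_def by blast
    ultimately show False using nofree by blast
  qed
  have "good E' d' W'"
    unfolding good_def using unc' ms' sep' W'conv op' nofree' by blast
  then obtain T where T: "T \<subseteq> E'" "uncountable T" "W_connected W' T"
    using assms(1) unfolding SOCA_def by blast
  then have "inj_on g T" by (metis inj_on_def ginj subsetD)
  then have "uncountable (g ` T)" using T by (simp add: countable_image_inj_eq)
  moreover have "g ` T \<subseteq> E" using T gE by blast
  moreover have "W_connected W (g ` T)"
    using T unfolding W_connected_def offdiag_def W'_def by blast
  ultimately show ?thesis by blast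
qed

end

theory Submission
  imports Defs
begin

text \<open>For distinct \<open>y, z\<close> in \<open>E\<close>, the point \<open>z\<close> lies in at most one of the sets \<open>\<pi> ` U y i\<close>, and
  \<open>y\<close> lies in at most one of the \<open>\<pi> ` U z i\<close>; so with three indices, one of them is left for which
  neither happens. Hence the relations \<open>W i\<close> saying that this happens for \<open>i\<close> cover all pairs. Two
  applications of SOCA then give an uncountable set that is connected for one \<open>W i\<close>, and on it
  the points \<open>x y i\<close> form a discrete set. The relations become open after shrinking \<open>U y i\<close> to a
  closed neighbourhood, whose image is closed, and refining the topology of \<open>E\<close> by countably
  many clopen sets.\<close>

text \<open>By total boundedness, for each \<open>n\<close> finitely many balls of radius
  \<open>inverse (Suc n)\<close> cover \<open>M\<close>; all of them together form a countable base.
  A ball of radius below \<open>r / 2\<close> that contains \<open>x\<close> stays inside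
  \<open>mball x r\<close>.\<close>

lemma (in Metric_space) compact_space_imp_second_countable:
  assumes "compact_space mtopology"
  shows "second_countable mtopology"
proof -
  have "mtotally_bounded M"
    using assms compactin_imp_mtotally_bounded[of M] by (simp add: compact_space_def)
  then have "\<forall>n. \<exists>K. finite K \<and> K \<subseteq> M \<and> M \<subseteq> (\<Union>x\<in>K. mball x (inverse (Suc n)))"
    by (simp add: mtotally_bounded_def)
  then obtain K where K: "\<And>n. finite (K n)" "\<And>n. K n \<subseteq> M"
    "\<And>n. M \<subseteq> (\<Union>x\<in>K n. mball x (inverse (Suc n)))"
    by metis
  define \<B> where "\<B> = (\<Union>n. (\<lambda>x. mball x (inverse (Suc n))) ` K n)"
  have "\<exists>V\<in>\<B>. x \<in> V \<and> V \<subseteq> U" if U: "openin mtopology U" "x \<in> U" for U x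
  proof -
    obtain r where r: "r > 0" "mball x r \<subseteq> U"
      using U by (auto simp: openin_mtopology)
    obtain n where n: "inverse (real (Suc n)) < r / 2"
      using r(1) by (metis half_gt_zero reals_Archimedean)
    have "x \<in> M"
      using U by (auto simp: openin_mtopology)
    then obtain c where c: "c \<in> K n" "x \<in> mball c (inverse (Suc n))"
      using K(3)[of n] by blast
    have "mball c (inverse (Suc n)) \<subseteq> mball x r"
    proof
      fix z assume z: "z \<in> mball c (inverse (Suc n))"
      then have "d x z \<le> d c x + d c z"
        using triangle[of x c z] c commute by (metis in_mball)
      then show "z \<in> mball x r"
        using c z n \<open>x \<in> M\<close> by auto
    qed
    then show ?thesis
      using c r unfolding \<B>_def by blast
  qed
  moreover have "countable \<B>"
    unfolding \<B>_def using K(1) by (simp add: countable_finite)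
  moreover have "\<forall>V\<in>\<B>. openin mtopology V"
    by (auto simp: \<B>_def)
  ultimately show ?thesis
    unfolding second_countable_def by blast
qed

text \<open>The hypothesis on \<open>W\<close> says that \<open>W\<close> is open for the topology on \<open>E\<close> in which all members of
  \<open>\<P>\<close> are clopen; this topology is induced by a map of \<open>E\<close> into the space of sequences.\<close>

lemma SOCA_clopen_family:
  fixes E :: "'b set" and \<P> :: "'b set set"
  assumes "SOCA" and E: "uncountable E" and \<P>: "countable \<P>"
    and sep: "\<And>y z. y \<in> E \<Longrightarrow> z \<in> E \<Longrightarrow> y \<noteq> z \<Longrightarrow> \<exists>S\<in>\<P>. (y \<in> S) \<noteq> (z \<in> S)"
    and W: "W \<subseteq> offdiag E" "W = W\<inverse>"
    and opn: "\<And>y z. (y, z) \<in> W \<Longrightarrow> \<exists>\<F>. finite \<F> \<and> \<F> \<subseteq> \<P> \<and>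
      (\<forall>y'\<in>E. \<forall>z'\<in>E. (\<forall>S\<in>\<F>. (y' \<in> S \<longleftrightarrow> y \<in> S) \<and> (z' \<in> S \<longleftrightarrow> z \<in> S)) \<longrightarrow> (y', z') \<in> W)"
  shows "\<exists>T\<subseteq>E. uncountable T \<and> (W_connected W T \<or> W_free W T)"
\<comment> \<open>If the conclusion fails, there is no uncountable free set, which is the last
  clause of \<open>good\<close>; SOCA then yields the connected set that was assumed
  missing.\<close>
proof (rule ccontr)
  assume contr: "\<not> ?thesis"
  have "\<P> \<noteq> {}"
  proof
    assume "\<P> = {}"
    then have "\<forall>y\<in>E. \<forall>z\<in>E. y = z"
      using sep by blast
    then have "finite E"
      by (metis finite.simps finite_subset insertI1 singletonI subsetI)
    then show False
      using E countable_finite by blast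
  qed
  define s where "s = from_nat_into \<P>"
  have s: "range s = \<P>"
    unfolding s_def using \<open>\<P> \<noteq> {}\<close> \<P> by (rule range_from_nat_into)
  \<comment> \<open>Each point is coded by its memberships in the sets \<open>s n\<close>. Real
    sequences form a separable metric space under the product topology, and pulling their metric
    back along the injective \<open>f\<close> makes every \<open>s n\<close> clopen relative to
    \<open>E\<close>.\<close>
  define f :: "'b \<Rightarrow> nat \<Rightarrow> real" where "f y n = indicator (s n) y" for y n
  have f: "f y n = f z n \<longleftrightarrow> (y \<in> s n \<longleftrightarrow> z \<in> s n)" for y z n
    by (auto simp: f_def indicator_def)
  have inj: "inj_on f E"
  proof (rule inj_onI, rule ccontr)
    fix y z assume yz: "y \<in> E" "z \<in> E" "f y = f z" "y \<noteq> z"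
    then obtain n where "(y \<in> s n) \<noteq> (z \<in> s n)"
      using sep s by blast
    then show False
      using f[of y n z] yz(3) by simp
  qed
  define d where "d y z = dist (f y) (f z)" for y z
  interpret D: Metric_space E d
    using inj by unfold_locales
      (auto simp: d_def dist_commute dist_triangle inj_on_eq_iff)
  have cf: "continuous_map D.mtopology euclidean f"
    using D.metric_continuous_map[OF Met_TC.Metric_space_axioms, of f] by (auto simp: d_def)
  have sep: "separable_space D.mtopology"
  proof -
    obtain C where C: "countable C" "C \<subseteq> f ` E" "f ` E \<subseteq> closure C"
      by (rule separable)
    then obtain C' where C': "C' \<subseteq> E" "C = f ` C'"
      by (meson subset_imageE)
    then have "countable C'"
      using C(1) inj countable_image_inj_eq inj_on_subset by metis
    moreover have "\<exists>c\<in>C'. c \<in> D.mball x r" if "x \<in> E" "r > 0" for x r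
    proof -
      have "f x \<in> closure C"
        using C that by blast
      then obtain c where "c \<in> C'" "dist (f c) (f x) < r"
        using C' \<open>r > 0\<close> unfolding closure_approachable by blast
      then show ?thesis
        using C' that by (auto simp: d_def dist_commute)
    qed
    ultimately have "D.mtopology closure_of C' = E"
      unfolding D.metric_closure_of by blast
    then show ?thesis
      unfolding separable_space_def using \<open>countable C'\<close> C'(1) by auto
  qed
  have opW: "openin (prod_topology D.mtopology D.mtopology) W"
  proof (subst openin_subopen, clarify)
    fix y z assume yz: "(y, z) \<in> W"
    from opn[OF yz] obtain \<F> where \<F>: "finite \<F>" "\<F> \<subseteq> \<P>"
      and WF: "\<forall>y'\<in>E. \<forall>z'\<in>E.
        (\<forall>S\<in>\<F>. (y' \<in> S \<longleftrightarrow> y \<in> S) \<and> (z' \<in> S \<longleftrightarrow> z \<in> S)) \<longrightarrow> (y', z') \<in> W"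
      by (elim exE conjE)
    obtain I where I: "finite I" "\<F> = s ` I"
      using finite_subset_image[of \<F> s UNIV] \<F> unfolding s by metis
    \<comment> \<open>Coordinates of \<open>f\<close> are 0 or 1, so distance below 1 forces
      equality: \<open>B a\<close> consists of the points of \<open>E\<close> that agree with
      \<open>a\<close> on \<open>\<F>\<close>. It is open because only finitely many coordinates are
      constrained.\<close>
    define B where "B a = {y \<in> topspace D.mtopology. f y \<in> {g. \<forall>i\<in>I. g i \<in> ball (f a i) 1}}" for a
    have opB: "openin D.mtopology (B a)" for a
      unfolding B_def
      by (rule openin_continuous_map_preimage[OF cf])
        (use product_topology_basis'[of I "\<lambda>i. ball (f a i) 1" "\<lambda>i. i"] I in \<open>simp add: open_fun_def\<close>)
    have memB: "b \<in> E \<and> (\<forall>S\<in>\<F>. b \<in> S \<longleftrightarrow> a \<in> S)" if "b \<in> B a" for a b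
      using that I by (auto simp: B_def f_def indicator_def dist_real_def split: if_splits)
    have yzE: "y \<in> E" "z \<in> E"
      using yz W by (auto simp: offdiag_def)
    show "\<exists>T. openin (prod_topology D.mtopology D.mtopology) T \<and> (y, z) \<in> T \<and> T \<subseteq> W"
    proof (intro exI conjI)
      show "openin (prod_topology D.mtopology D.mtopology) (B y \<times> B z)"
        by (simp add: openin_prod_Times_iff opB)
      show "(y, z) \<in> B y \<times> B z"
        using yzE by (auto simp: B_def)
      show "B y \<times> B z \<subseteq> W"
      proof clarify
        fix y' z' assume "y' \<in> B y" "z' \<in> B z"
        with memB[of y' y] memB[of z' z] show "(y', z') \<in> W"
          using WF by simp
      qed
    qed
  qed
  have "openin (subtopology (prod_topology D.mtopology D.mtopology) (offdiag E)) W"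
    using opW W by (auto simp: openin_subtopology)
  then have "good E d W"
    unfolding good_def using E sep W D.Metric_space_axioms contr by blast
  then show False
    using SOCA_any_type[OF \<open>SOCA\<close>] contr by blast
qed

theorem theorem4p1:
  fixes X :: "'a topology" and Y E :: "'b set" and d :: "'b \<Rightarrow> 'b \<Rightarrow> real"
    and \<pi> :: "'a \<Rightarrow> 'b"
  assumes "SOCA"
    and "compact_space X" and "Hausdorff_space X"
    and "Metric_space Y d" and "compact_space (Metric_space.mtopology Y d)"
    and "continuous_map X (Metric_space.mtopology Y d) \<pi>"
    and "\<pi> ` topspace X = Y"
    and "E \<subseteq> Y" and "uncountable E"
    and "\<forall>y\<in>E. \<exists>(x :: nat \<Rightarrow> 'a) (U :: nat \<Rightarrow> 'a set).
           (\<forall>i\<in>{0, 1, 2}. x i \<in> topspace X \<and> \<pi> (x i) = y \<and> openin X (U i) \<and> x i \<in> U i) \<and>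
           (\<forall>i\<in>{0, 1, 2}. \<forall>j\<in>{0, 1, 2}. i \<noteq> j \<longrightarrow>
              U i \<inter> U j = {} \<and> \<pi> ` U i \<inter> \<pi> ` U j = {y})"
  shows "\<exists>D. D \<subseteq> topspace X \<and> uncountable D \<and> subtopology X D = discrete_topology D"
proof -
  interpret Y: Metric_space Y d by fact
  define I where "I = {0, 1, 2 :: nat}"
  obtain x :: "'b \<Rightarrow> nat \<Rightarrow> 'a" and U :: "'b \<Rightarrow> nat \<Rightarrow> 'a set" where
    xU: "\<And>y i. y \<in> E \<Longrightarrow> i \<in> I \<Longrightarrow>
        x y i \<in> topspace X \<and> \<pi> (x y i) = y \<and> openin X (U y i) \<and> x y i \<in> U y i"
    and disj: "\<And>y i j. y \<in> E \<Longrightarrow> i \<in> I \<Longrightarrow> j \<in> I \<Longrightarrow> i \<noteq> j \<Longrightarrow> \<pi> ` U y i \<inter> \<pi> ` U y j = {y}"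
    using assms(10) unfolding I_def[symmetric] by metis
  have "regular_space X"
    using assms(2,3) by (rule compact_Hausdorff_imp_regular_space)
  then have nb: "\<exists>V K. openin X V \<and> closedin X K \<and> x y i \<in> V \<and> V \<subseteq> K \<and> K \<subseteq> U y i"
    if "y \<in> E" "i \<in> I" for y i
    using xU[OF that] unfolding neighbourhood_base_of_closedin[symmetric] neighbourhood_base_of by blast
  obtain V K where VK: "\<And>y i. y \<in> E \<Longrightarrow> i \<in> I \<Longrightarrow>
      openin X (V y i) \<and> closedin X (K y i) \<and> x y i \<in> V y i \<and> V y i \<subseteq> K y i \<and> K y i \<subseteq> U y i"
    using nb by metis
  \<comment> \<open>\<open>K y i\<close> is compact, so its image is closed in the metric space; the
    image of \<open>U y i\<close> need not be.\<close>
  define A where "A y i = \<pi> ` K y i" for y i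
  have clA: "closedin Y.mtopology (A y i)" if "y \<in> E" "i \<in> I" for y i
    unfolding A_def
    using VK[OF that] assms(2,6) Y.Hausdorff_space_mtopology
    by (intro compactin_imp_closedin image_compactin[of X]) (auto intro: closedin_compact_space)
  obtain \<B> where \<B>: "countable \<B>"
    and base: "\<And>G y. openin Y.mtopology G \<Longrightarrow> y \<in> G \<Longrightarrow> \<exists>M\<in>\<B>. y \<in> M \<and> M \<subseteq> G"
    using Y.compact_space_imp_second_countable[OF assms(5)] unfolding second_countable_def by metis
  \<comment> \<open>That \<open>z\<close> lies outside the closed set \<open>A y i\<close> is
    witnessed by some \<open>M\<close> in \<open>\<B>\<close> with \<open>z \<in> M\<close> and
    \<open>y \<in> miss i M\<close>. Nothing controls how \<open>A y i\<close> varies with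
    \<open>y\<close>, so the sets \<open>miss i M\<close> are added to the clopen family.\<close>
  define miss where "miss i M = {y. A y i \<inter> M = {}}" for i M
  define \<P> where "\<P> = \<B> \<union> (\<Union>i\<in>I. miss i ` \<B>)"
  have "countable \<P>"
    using \<B> by (auto simp: \<P>_def I_def)
  have sep: "\<exists>M\<in>\<B>. z \<in> M \<and> C \<inter> M = {}" if "closedin Y.mtopology C" "z \<in> Y" "z \<notin> C" for C z
  proof -
    have "openin Y.mtopology (Y - C)"
      using that(1) by (simp add: closedin_def)
    then obtain M where "M \<in> \<B>" "z \<in> M" "M \<subseteq> Y - C"
      using base[of "Y - C" z] \<open>z \<in> Y\<close> \<open>z \<notin> C\<close> by blast
    then show ?thesis
      by blast
  qed
  have sepE: "\<exists>S\<in>\<P>. (y \<in> S) \<noteq> (z \<in> S)" if "y \<in> E" "z \<in> E" "y \<noteq> z" for y z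
  proof -
    have "closedin Y.mtopology {y}"
      using that assms(8) Y.Hausdorff_space_mtopology by (intro compactin_imp_closedin) auto
    then obtain M where "M \<in> \<B>" "z \<in> M" "y \<notin> M"
      using sep[of "{y}" z] \<open>z \<in> E\<close> \<open>y \<noteq> z\<close> assms(8) by blast
    then show ?thesis
      unfolding \<P>_def by blast
  qed
  define W where "W T i = {(y, z) \<in> offdiag T. z \<notin> A y i \<and> y \<notin> A z i}" for T i
  have colour: "\<exists>S\<subseteq>T. uncountable S \<and> (W_connected (W T i) S \<or> W_free (W T i) S)"
    if T: "T \<subseteq> E" "uncountable T" and i: "i \<in> I" for T i
  proof (rule SOCA_clopen_family[OF \<open>SOCA\<close> T(2) \<open>countable \<P>\<close>])
    show "\<exists>S\<in>\<P>. (y \<in> S) \<noteq> (z \<in> S)" if "y \<in> T" "z \<in> T" "y \<noteq> z" for y z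
      using sepE[OF subsetD[OF T(1)] subsetD[OF T(1)]] that .
    show "W T i \<subseteq> offdiag T"
      by (auto simp: W_def)
    show "W T i = (W T i)\<inverse>"
      by (auto simp: W_def offdiag_def)
  next
    fix y z assume "(y, z) \<in> W T i"
    then have yz: "y \<in> E" "z \<in> E" "y \<in> Y" "z \<in> Y" "z \<notin> A y i" "y \<notin> A z i"
      using T assms(8) by (auto simp: W_def offdiag_def)
    obtain M where M: "M \<in> \<B>" "z \<in> M" "A y i \<inter> M = {}"
      using sep[OF clA] yz i by metis
    obtain N where N: "N \<in> \<B>" "y \<in> N" "A z i \<inter> N = {}"
      using sep[OF clA] yz i by metis
    show "\<exists>\<F>. finite \<F> \<and> \<F> \<subseteq> \<P> \<and> (\<forall>y'\<in>T. \<forall>z'\<in>T.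
        (\<forall>S\<in>\<F>. (y' \<in> S \<longleftrightarrow> y \<in> S) \<and> (z' \<in> S \<longleftrightarrow> z \<in> S)) \<longrightarrow> (y', z') \<in> W T i)"
    proof (intro exI conjI ballI impI)
      show "finite {M, miss i M, N, miss i N}" "{M, miss i M, N, miss i N} \<subseteq> \<P>"
        using M N i by (auto simp: \<P>_def)
    next
      fix y' z'
      assume T': "y' \<in> T" "z' \<in> T"
        and eq: "\<forall>S\<in>{M, miss i M, N, miss i N}. (y' \<in> S \<longleftrightarrow> y \<in> S) \<and> (z' \<in> S \<longleftrightarrow> z \<in> S)"
      have "z' \<in> M" "A y' i \<inter> M = {}" "y' \<in> N" "A z' i \<inter> N = {}"
        using eq M N by (auto simp: miss_def)
      \<comment> \<open>This gives \<open>y' \<noteq> z'\<close>, since \<open>z'\<close> lies in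
        \<open>M\<close> and hence outside \<open>A y' i\<close>; so the pair is off the
        diagonal.\<close>
      moreover have "y' \<in> A y' i"
        using VK[of y' i] xU[of y' i] T' T i unfolding A_def by force
      ultimately show "(y', z') \<in> W T i"
        using T' by (auto simp: W_def offdiag_def)
    qed
  qed
  have cover: "(y, z) \<in> W T 0 \<or> (y, z) \<in> W T 1 \<or> (y, z) \<in> W T 2"
    if T: "T \<subseteq> E" "(y, z) \<in> offdiag T" for T y z
  proof -
    have yz: "y \<in> E" "z \<in> E" "y \<noteq> z"
      using T by (auto simp: offdiag_def)
    \<comment> \<open>The images of \<open>U a i\<close> and \<open>U a j\<close> meet only in
      \<open>a\<close>. Thus \<open>z\<close> excludes at most one index through
      \<open>A y i\<close>, and \<open>y\<close> at most one through \<open>A z i\<close>.\<close>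
    have one: "i = j" if "b \<in> A a i" "b \<in> A a j" "a \<in> E" "a \<noteq> b" "i \<in> I" "j \<in> I" for a b i j
    proof (rule ccontr)
      assume "i \<noteq> j"
      have "A a i \<subseteq> \<pi> ` U a i" "A a j \<subseteq> \<pi> ` U a j"
        unfolding A_def using VK[of a i] VK[of a j] that by (intro image_mono; simp)+
      then have "b \<in> \<pi> ` U a i \<inter> \<pi> ` U a j"
        using \<open>b \<in> A a i\<close> \<open>b \<in> A a j\<close> by (meson IntI subsetD)
      then show False
        using disj[OF \<open>a \<in> E\<close> \<open>i \<in> I\<close> \<open>j \<in> I\<close> \<open>i \<noteq> j\<close>] \<open>a \<noteq> b\<close> by simp
    qed
    have I: "0 \<in> I" "1 \<in> I" "2 \<in> I" "(0::nat) \<noteq> 1" "(0::nat) \<noteq> 2" "(1::nat) \<noteq> 2"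
      by (auto simp: I_def)
    have W_iff: "(y, z) \<in> W T i \<longleftrightarrow> z \<notin> A y i \<and> y \<notin> A z i" for i
      using T(2) by (auto simp: W_def)
    show ?thesis
      unfolding W_iff using one[of y z] one[of z y] yz I by metis
  qed
  have discrete: ?thesis
    if T: "T \<subseteq> E" "uncountable T" and i: "i \<in> I"
      and conn: "\<And>y z. (y, z) \<in> offdiag T \<Longrightarrow> z \<notin> A y i" for T i
  proof (intro exI conjI)
    let ?D = "(\<lambda>y. x y i) ` T"
    have x: "x y i \<in> topspace X" "\<pi> (x y i) = y" if "y \<in> T" for y
      using xU[of y i] T(1) i that by auto
    have V: "openin X (V y i)" "x y i \<in> V y i" "\<pi> ` V y i \<subseteq> A y i" if "y \<in> T" for y
      using VK[of y i] T(1) i that by (auto simp: A_def)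
    have "inj_on (\<lambda>y. x y i) T"
      by (rule inj_on_inverseI[of _ \<pi>]) (rule x)
    then show "uncountable ?D"
      using T(2) by (simp add: countable_image_inj_eq)
    show sub: "?D \<subseteq> topspace X"
      using x(1) by auto
    have "openin (subtopology X ?D) {x y i}" if "y \<in> T" for y
    proof -
      \<comment> \<open>The open set \<open>V y i\<close> isolates \<open>x y i\<close>: a point
        \<open>x z i\<close> inside it would put its image \<open>z\<close> into
        \<open>A y i\<close>, against \<open>conn\<close>.\<close>
      have "z = y" if "z \<in> T" "x z i \<in> V y i" for z
      proof (rule ccontr)
        assume "z \<noteq> y"
        have "z \<in> A y i"
          using V(3)[OF \<open>y \<in> T\<close>] x(2)[OF \<open>z \<in> T\<close>] \<open>x z i \<in> V y i\<close> by (metis imageI subsetD)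
        then show False
          using conn[of y z] \<open>z \<noteq> y\<close> \<open>y \<in> T\<close> \<open>z \<in> T\<close> by (auto simp: offdiag_def)
      qed
      then have "{x y i} = V y i \<inter> ?D"
        using V(2)[OF \<open>y \<in> T\<close>] \<open>y \<in> T\<close> by auto
      then show ?thesis
        using V(1)[OF \<open>y \<in> T\<close>] unfolding openin_subtopology by blast
    qed
    then show "subtopology X ?D = discrete_topology ?D"
      using sub discrete_topology_unique[of ?D "subtopology X ?D"] by (simp add: Int_absorb1 eq_commute)
  qed
  show ?thesis
  proof (rule ccontr)
    assume no: "\<not> ?thesis"
    \<comment> \<open>A connected set would give an uncountable discrete set by
      \<open>discrete\<close>, so only the free alternative of \<open>colour\<close>
      remains.\<close>
    have step: "\<exists>S\<subseteq>T. uncountable S \<and> W_free (W T i) S"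
      if T: "T \<subseteq> E" "uncountable T" and i: "i \<in> I" for T i
    proof -
      obtain S where S: "S \<subseteq> T" "uncountable S" "W_connected (W T i) S \<or> W_free (W T i) S"
        using colour[OF T i] by blast
      have "\<not> W_connected (W T i) S"
      proof
        assume "W_connected (W T i) S"
        then have conn: "z \<notin> A y i" if "(y, z) \<in> offdiag S" for y z
          using that by (auto simp: W_connected_def W_def)
        have "S \<subseteq> E"
          using S(1) T(1) by (rule subset_trans)
        from discrete[OF this S(2) i conn] no show False
          by (rule notE[rotated])
      qed
      then show ?thesis
        using S by blast
    qed
    have I: "0 \<in> I" "1 \<in> I" "2 \<in> I"
      by (auto simp: I_def)
    obtain S where S: "S \<subseteq> E" "uncountable S" "W_free (W E 0) S"
      using step[OF subset_refl assms(9) I(1)] by blast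
    obtain T where T: "T \<subseteq> S" "uncountable T" "W_free (W S 1) T"
      using step[OF S(1,2) I(2)] by blast
    have "T \<subseteq> E"
      using T(1) S(1) by (rule subset_trans)
    \<comment> \<open>Pairs from \<open>T\<close> avoid colours 0 and 1, as freeness of
      \<open>S\<close> passes to its subset \<open>T\<close>; by \<open>cover\<close> they all have
      colour 2. Off the diagonal of \<open>T\<close>, the sets \<open>W E 0\<close> and
      \<open>W S 1\<close> impose the same conditions as \<open>W T 0\<close> and
      \<open>W T 1\<close>.\<close>
    have "z \<notin> A y 2" if yz: "(y, z) \<in> offdiag T" for y z
    proof -
      have "(y, z) \<in> offdiag S"
        using yz T(1) unfolding offdiag_def by blast
      moreover from this have "(y, z) \<in> offdiag E"
        using S(1) unfolding offdiag_def by blast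
      ultimately have "(y, z) \<notin> W T 0" "(y, z) \<notin> W T 1"
        using S(3) T(3) yz by (auto simp: W_free_def W_def)
      then have "(y, z) \<in> W T 2"
        using cover[OF \<open>T \<subseteq> E\<close> yz] by blast
      then show ?thesis
        by (auto simp: W_def)
    qed
    from discrete[OF \<open>T \<subseteq> E\<close> T(2) I(3) this] no show False
      by (rule notE[rotated])
  qed
qed

end
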